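(* If $f(z)=z+\sum_{n=2}^{\infty}a_nz^n\in \mathcal{S}_{S,L}^*$, then $$|H_{2,3}(f^{-1})|=|A_3A_5-A_4^2|\leq\frac{3}{64}.$$ The inequality is sharp.
   Context: $\mathbb{D}=\{z\in\mathbb{C}:|z|<1\}$. $\mathcal{S}$ is the class of univalent (injective) analytic functions $f$ on $\mathbb{D}$ with expansion $f(z)=z+\sum_{n\ge 2}a_nz^n$. For analytic $g,h$ on $\mathbb{D}$, $g\prec h$ (subordination) means $g=h\circ w$ for some analytic $w:\mathbb{D}\to\mathbb{D}$ with $w(0)=0$. The class is $$\mathcal{S}_{S,L}^*=\left\{f\in\mathcal{S}:\ \frac{2zf'(z)}{f(z)-f(-z)}\prec \sqrt{1+z}\right\}$$ (principal branch of the square root). For $f\in\mathcal{S}$, the inverse function near $0$ is $f^{-1}(w)=w+A_2w^2+A_3w^3+A_4w^4+A_5w^5+\cdots$, and $H_{2,3}(f^{-1}):=A_3A_5-A_4^2$. "Sharp" means that equality is attained by some function in the class. *)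

theory Defs
  imports "HOL-Complex_Analysis.Complex_Analysis"
begin

abbreviation unit_disk :: "complex set" ("\<D>") where
  "\<D> \<equiv> ball 0 1"

text \<open>
  The expansion \<open>f z = z + (\<Sum>n\<ge>2. a n * z ^ n)\<close> of a function analytic on the disk means
  that its Taylor coefficients of order 0 and 1 are 0 and 1.
\<close>

definition class_S :: "(complex \<Rightarrow> complex) set" where
  "class_S = {f. f holomorphic_on \<D> \<and> inj_on f \<D> \<and> f 0 = 0 \<and> deriv f 0 = 1}"

text \<open>
  Intended for \<open>g\<close> and \<open>h\<close> analytic on the disk; analyticity of \<open>g\<close> follows from that of \<open>h\<close>.
\<close>

definition subordinate :: "(complex \<Rightarrow> complex) \<Rightarrow> (complex \<Rightarrow> complex) \<Rightarrow> bool"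
    (infix "\<prec>\<^sub>D" 50) where
  "g \<prec>\<^sub>D h \<longleftrightarrow>
     (\<exists>w. w holomorphic_on \<D> \<and> w ` \<D> \<subseteq> \<D> \<and> w 0 = 0 \<and> (\<forall>z\<in>\<D>. g z = h (w z)))"

text \<open>
  For \<open>f\<close> in \<open>class_S\<close> the denominator vanishes in the disk only at 0, by injectivity. The
  singularity there is removable, with value \<open>2 * f' 0 / (2 * f' 0) = 1\<close>; this has to be set
  explicitly because \<open>0 / 0 = 0\<close> in HOL.
\<close>

definition sakaguchi_quotient :: "(complex \<Rightarrow> complex) \<Rightarrow> complex \<Rightarrow> complex" where
  "sakaguchi_quotient f z = (if z = 0 then 1 else 2 * z * deriv f z / (f z - f (- z)))"

definition class_S_SL :: "(complex \<Rightarrow> complex) set" where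
  "class_S_SL = {f \<in> class_S. sakaguchi_quotient f \<prec>\<^sub>D (\<lambda>z. csqrt (1 + z))}"

text \<open>
  The inverse of a univalent \<open>f\<close> is taken on the whole image \<open>f ` \<D>\<close>, an open neighbourhood
  of 0. Values of \<open>inv_into\<close> outside the image do not affect the Taylor coefficients at 0.
\<close>

definition inverse_coeff :: "(complex \<Rightarrow> complex) \<Rightarrow> nat \<Rightarrow> complex" where
  "inverse_coeff f n = fps_nth (fps_expansion (inv_into \<D> f) 0) n"

definition hankel_2_3_inverse :: "(complex \<Rightarrow> complex) \<Rightarrow> complex" where
  "hankel_2_3_inverse f =
     inverse_coeff f 3 * inverse_coeff f 5 - (inverse_coeff f 4)\<^sup>2"

end

theory Submission
  imports Defs
begin

text \<open>
  Write \<open>2 z f'(z) / (f(z) - f(-z)) = sqrt (1 + w(z))\<close> with \<open>w\<close> a Schwarz function. Comparing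
  coefficients makes the Hankel determinant a polynomial in the first four coefficients of \<open>w\<close>.
  Two steps of the Schur algorithm express these by \<open>c = w'(0)\<close> and the first three coefficients
  \<open>x, s, t\<close> of a function bounded by 1 in the disk, where \<open>|s|, |t| \<le> 1 - |x|\<^sup>2\<close>. In these
  parameters the triangle inequality loses nothing at the extremal point \<open>c = 0, |x| = 1\<close>, and
  leaves a polynomial inequality in \<open>|c|\<close> and \<open>|x|\<close> on the unit square. The choice \<open>w(z) = z\<^sup>2\<close> gives
  equality; the corresponding \<open>f\<close> is elementary.
\<close>

subsection \<open>Coefficients of bounded functions\<close>

text \<open>Schwarz's lemma bounds the quotient away from 0 by \<open>|f z| \<le> |z|\<close> and at
  0 through the derivative. The bound is not strict because a rotation yields a unimodular
  constant.\<close>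

lemma schwarz_quotient:
  assumes "f holomorphic_on \<D>" "f 0 = 0" "\<And>z. z \<in> \<D> \<Longrightarrow> norm (f z) < 1"
  obtains h where "h holomorphic_on \<D>" "\<And>z. z \<in> \<D> \<Longrightarrow> norm (h z) \<le> 1"
    "\<And>z. z \<in> \<D> \<Longrightarrow> f z = z * h z"
proof -
  obtain h where h: "h holomorphic_on \<D>" "\<And>z. norm z < 1 \<Longrightarrow> f z = z * h z" "deriv f 0 = h 0"
    using Schwarz3[OF assms(1,2)] by blast
  have "norm (h z) \<le> 1" if z: "norm z < 1" for z
  proof (cases "z = 0")
    case True
    then show ?thesis
      using Schwarz_Lemma(2)[OF assms(1,2), of 0] assms(3) h(3) by simp
  next
    case False
    have "norm z * norm (h z) \<le> norm z * 1"
      using Schwarz_Lemma(1)[OF assms(1,2) _ z] assms(3) h(2)[OF z] by (simp add: norm_mult)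
    then show ?thesis
      using False by simp
  qed
  with h show ?thesis
    by (intro that[of h]) auto
qed

text \<open>Settles the degenerate case of the Schur algorithm, where \<open>g\<close> is a
  unimodular constant and no further step is possible.\<close>

lemma max_modulus_attained_at_0:
  assumes "g holomorphic_on \<D>" "\<And>z. z \<in> \<D> \<Longrightarrow> norm (g z) \<le> 1" "norm (g 0) = 1" "z \<in> \<D>"
  shows "g z = g 0"
proof -
  have "g constant_on \<D>"
    by (rule maximum_modulus_principle[OF assms(1), where U = \<D> and \<xi> = 0]) (use assms in auto)
  then show ?thesis
    using assms(4) by (force simp: constant_on_def)
qed

text \<open>The Moebius map moving \<open>g 0\<close> to 0 is stated without the quotient, so that both sides can be
  compared as power series.\<close>

lemma schur_step:
  assumes "g holomorphic_on \<D>" "\<And>z. z \<in> \<D> \<Longrightarrow> norm (g z) \<le> 1" "norm (g 0) < 1"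
  obtains h where "h holomorphic_on \<D>" "\<And>z. z \<in> \<D> \<Longrightarrow> norm (h z) \<le> 1"
    "\<And>z. z \<in> \<D> \<Longrightarrow> g z * (1 + cnj (g 0) * (z * h z)) = g 0 + z * h z"
proof -
  define c where "c = g 0"
  \<comment> \<open>A value of modulus 1 would be an interior maximum, making \<open>g\<close>
    constant against \<open>norm (g 0) < 1\<close>.\<close>
  have lt: "norm (g z) < 1" if "z \<in> \<D>" for z
  proof (rule ccontr)
    assume "\<not> norm (g z) < 1"
    then have eq: "norm (g z) = 1"
      using assms(2)[OF that] by simp
    have "g constant_on \<D>"
      by (rule maximum_modulus_principle[OF assms(1), where U = \<D> and \<xi> = z]) 
        (use assms(2) eq that in auto)
    then have "g z = g 0"
      using that unfolding constant_on_def by force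
    then show False
      using eq assms(3) by simp
  qed
  define u where "u z = (g z - c) / (1 - cnj c * g z)" for z
  have nz: "1 - cnj c * g z \<noteq> 0" if "z \<in> \<D>" for z
  proof
    assume "1 - cnj c * g z = 0"
    then have "norm (cnj c * g z) = 1" by simp
    moreover have "norm c * norm (g z) < 1 * 1"
      using lt[OF that] assms(3) by (intro mult_strict_mono') (auto simp: c_def)
    ultimately show False
      by (simp add: norm_mult)
  qed
  have "u holomorphic_on \<D>"
    unfolding u_def using assms(1) nz by (intro holomorphic_intros) auto
  moreover have "u 0 = 0"
    by (simp add: u_def c_def)
  moreover have "norm (u z) < 1" if "z \<in> \<D>" for z
  proof -
    have "(1 - (norm c)\<^sup>2) * (1 - (norm (g z))\<^sup>2) > 0"
      using lt[OF that] assms(3) by (simp add: c_def abs_square_less_1)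
    \<comment> \<open>The identity behind disk automorphisms. It is checked over the complex
      numbers, where \<open>|v|^2 = v * cnj v\<close>, and then read back in the reals.\<close>
    moreover have "complex_of_real ((norm (1 - cnj c * g z))\<^sup>2 - (norm (g z - c))\<^sup>2) =
        of_real ((1 - (norm c)\<^sup>2) * (1 - (norm (g z))\<^sup>2))"
      by (simp only: of_real_diff of_real_mult of_real_1 complex_norm_square) 
        (simp add: algebra_simps)
    then have "(norm (1 - cnj c * g z))\<^sup>2 - (norm (g z - c))\<^sup>2 = (1 - (norm c)\<^sup>2) * (1 - (norm (g z))\<^sup>2)"
      by (simp only: of_real_eq_iff)
    ultimately have "(norm (g z - c))\<^sup>2 < (norm (1 - cnj c * g z))\<^sup>2"
      by linarith
    then show ?thesis
      using nz[OF that] by (simp add: u_def norm_divide power_less_imp_less_base)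
  qed
  ultimately obtain h where h: "h holomorphic_on \<D>" "\<And>z. z \<in> \<D> \<Longrightarrow> norm (h z) \<le> 1"
    "\<And>z. z \<in> \<D> \<Longrightarrow> u z = z * h z"
    using schwarz_quotient by blast
  have "g z * (1 + cnj (g 0) * (z * h z)) = g 0 + z * h z" if "z \<in> \<D>" for z
    unfolding h(3)[OF that, symmetric] using nz[OF that]
    by (simp add: u_def c_def field_simps)
  with h show ?thesis
    using that by blast
qed

section \<open>Schur steps on power series and coefficient estimates\<close>

lemma fps_expansion_disk:
  assumes "f holomorphic_on \<D>"
  shows "f has_fps_expansion fps_expansion f 0"
  using assms by (intro has_fps_expansion_fps_expansion[of \<D>]) auto

lemma fps_eq_on_disk:
  assumes "f has_fps_expansion F" "g has_fps_expansion G" "\<And>z. z \<in> \<D> \<Longrightarrow> f z = g z"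
  shows "F = G"
proof -
  have "eventually (\<lambda>z. z \<in> \<D>) (nhds 0)"
    by (intro eventually_nhds_in_open) auto
  then have "eventually (\<lambda>z. f z = g z) (nhds 0)"
    by eventually_elim (use assms(3) in auto)
  then have "g has_fps_expansion F"
    using assms(1) has_fps_expansion_cong by blast
  then show ?thesis
    using assms(2) fps_expansion_unique_complex by blast
qed

lemma fps_nth_0_expansion:
  fixes f :: "complex \<Rightarrow> complex"
  assumes "f has_fps_expansion F"
  shows "fps_nth F 0 = f 0"
  using fps_nth_fps_expansion[OF assms, of 0] by simp

lemma fps_expansion_constant_on_disk:
  assumes "f has_fps_expansion F" "\<And>z. z \<in> \<D> \<Longrightarrow> f z = c"
  shows "F = fps_const c"
  using assms by (intro fps_eq_on_disk[OF assms(1) has_fps_expansion_const]) auto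

text \<open>Comparing coefficients in this identity expresses those of \<open>G\<close> recursively
  by those of \<open>H\<close>.\<close>

lemma schur_step_fps:
  assumes "g holomorphic_on \<D>" "\<And>z. z \<in> \<D> \<Longrightarrow> norm (g z) \<le> 1" "norm (g 0) < 1"
    and G: "g has_fps_expansion G"
  obtains h H where "h holomorphic_on \<D>" "\<And>z. z \<in> \<D> \<Longrightarrow> norm (h z) \<le> 1"
    "h has_fps_expansion H"
    "G * (1 + fps_const (cnj (fps_nth G 0)) * (fps_X * H)) = fps_const (fps_nth G 0) + fps_X * H"
proof -
  obtain h where h: "h holomorphic_on \<D>" "\<And>z. z \<in> \<D> \<Longrightarrow> norm (h z) \<le> 1"
    "\<And>z. z \<in> \<D> \<Longrightarrow> g z * (1 + cnj (g 0) * (z * h z)) = g 0 + z * h z"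
    using schur_step[OF assms(1-3)] by blast
  define H where "H = fps_expansion h 0"
  have H: "h has_fps_expansion H"
    unfolding H_def using h(1) by (rule fps_expansion_disk)
  have "G * (1 + fps_const (cnj (fps_nth G 0)) * (fps_X * H)) = fps_const (fps_nth G 0) + fps_X * H"
    by (rule fps_eq_on_disk[where f = "\<lambda>z. g z * (1 + cnj (g 0) * (z * h z))"
          and g = "\<lambda>z. g 0 + z * h z"])
      (auto intro!: fps_expansion_intros G H h(3) simp: fps_nth_0_expansion[OF G])
  with h H show ?thesis
    using that by blast
qed

text \<open>With \<open>c = g 0\<close>, the linear coefficient of the Schur identity gives
  \<open>fps_nth G 1 = (1 - |c|^2) * h 0\<close>, where \<open>|h 0| \<le> 1\<close>. If
  \<open>|c| = 1\<close>, then \<open>g\<close> is constant and both sides vanish.\<close>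

lemma schwarz_pick_coeff_1:
  assumes "g holomorphic_on \<D>" "\<And>z. z \<in> \<D> \<Longrightarrow> norm (g z) \<le> 1" "g has_fps_expansion G"
  shows "norm (fps_nth G 1) \<le> 1 - (norm (fps_nth G 0))\<^sup>2"
proof (cases "norm (g 0) = 1")
  case True
  then have "G = fps_const (g 0)"
    using max_modulus_attained_at_0 assms
    by (intro fps_expansion_constant_on_disk[OF assms(3)]) blast
  then show ?thesis
    using True by simp
next
  case False
  with assms(2)[of 0] have "norm (g 0) < 1" by simp
  then obtain h H where h: "h holomorphic_on \<D>" "\<And>z. z \<in> \<D> \<Longrightarrow> norm (h z) \<le> 1"
    "h has_fps_expansion H"
    "G * (1 + fps_const (cnj (fps_nth G 0)) * (fps_X * H)) = fps_const (fps_nth G 0) + fps_X * H"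
    using schur_step_fps[OF assms(1,2) _ assms(3)] by blast
  define c where "c = fps_nth G 0"
  from arg_cong[OF h(4), of "\<lambda>F. fps_nth F 1"] have "fps_nth G 1 + c * (cnj c * h 0) = h 0"
    by (simp add: c_def fps_nth_0_expansion[OF h(3)] algebra_simps)
  then have "fps_nth G 1 = of_real (1 - (norm c)\<^sup>2) * h 0"
    by (simp only: of_real_diff of_real_1 complex_norm_square) (simp add: algebra_simps)
  then have "norm (fps_nth G 1) = \<bar>1 - (norm c)\<^sup>2\<bar> * norm (h 0)"
    by (simp only: norm_mult norm_of_real)
  also have "\<dots> \<le> \<bar>1 - (norm c)\<^sup>2\<bar> * 1"
    using h(2)[of 0] by (intro mult_left_mono) auto
  also have "norm c \<le> 1"
    using assms(2)[of 0] by (simp add: c_def fps_nth_0_expansion[OF assms(3)])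
  then have "\<bar>1 - (norm c)\<^sup>2\<bar> * 1 = 1 - (norm c)\<^sup>2"
    by (simp add: power_le_one)
  finally show ?thesis
    by (simp add: c_def)
qed

text \<open>The even part of \<open>g\<close> has no linear term, so its Schur transform vanishes at 0.\<close>

lemma schwarz_pick_coeff_2:
  assumes "g holomorphic_on \<D>" "\<And>z. z \<in> \<D> \<Longrightarrow> norm (g z) \<le> 1" "g has_fps_expansion G"
  shows "norm (fps_nth G 2) \<le> 1 - (norm (fps_nth G 0))\<^sup>2"
proof -
  define k where "k z = (g z + g (- z)) / 2" for z
  define K where "K = fps_const (1/2) * (G + (G oo - fps_X))"
  have m: "(\<lambda>z. g (- z)) has_fps_expansion (G oo - fps_X)"
    using has_fps_expansion_compose[OF assms(3), of uminus "- fps_X"]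
    by (simp add: o_def has_fps_expansion_minus has_fps_expansion_fps_X)
  have K: "k has_fps_expansion K"
    unfolding K_def k_def divide_inverse mult.commute[of _ "inverse 2"] mult_1_left mult_1_right
    by (intro has_fps_expansion_mult has_fps_expansion_add has_fps_expansion_const assms(3) m)
  have nth_K: "fps_nth K n = (1 + (-1) ^ n) / 2 * fps_nth G n" for n
    by (simp add: K_def fps_compose_uminus' field_simps)
  have "(\<lambda>z. g (- z)) holomorphic_on \<D>"
    using holomorphic_on_compose_gen[of uminus \<D> g \<D>] assms(1) holomorphic_on_minus[OF holomorphic_on_ident]
    by (auto simp: o_def image_subset_iff)
  then have hk: "k holomorphic_on \<D>"
    unfolding k_def using assms(1) by (intro holomorphic_intros) auto
  have bk: "norm (k z) \<le> 1" if "z \<in> \<D>" for z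
    using norm_triangle_ineq[of "g z" "g (- z)"] assms(2)[of z] assms(2)[of "- z"] that
    by (simp add: k_def norm_divide)
  have K0: "fps_nth K 0 = fps_nth G 0" "fps_nth K 1 = 0" "fps_nth K 2 = fps_nth G 2"
    by (simp_all add: nth_K)
  show ?thesis
  proof (cases "norm (k 0) = 1")
    case True
    then have "K = fps_const (k 0)"
      using max_modulus_attained_at_0 hk bk
      by (intro fps_expansion_constant_on_disk[OF K]) blast
    then show ?thesis
      using True K0 by simp
  next
    case False
    with bk[of 0] have lt: "norm (k 0) < 1" by simp
    then obtain h H where h: "h holomorphic_on \<D>" "\<And>z. z \<in> \<D> \<Longrightarrow> norm (h z) \<le> 1"
      "h has_fps_expansion H"
      "K * (1 + fps_const (cnj (fps_nth K 0)) * (fps_X * H)) = fps_const (fps_nth K 0) + fps_X * H"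
      using schur_step_fps[OF hk bk _ K] by blast
    define c where "c = fps_nth K 0"
    have c1: "norm c < 1"
      using lt by (simp add: c_def fps_nth_0_expansion[OF K])
    then have c2: "0 < 1 - (norm c)\<^sup>2"
      by (simp add: abs_square_less_1)
    then have c3: "c * cnj c \<noteq> 1"
      using complex_norm_square[of c] by (metis diff_self less_irrefl of_real_eq_1_iff)
    have "c * (cnj c * fps_nth H 0) = fps_nth H 0"
      using arg_cong[OF h(4), of "\<lambda>F. fps_nth F 1"] K0(2) by (simp add: c_def)
    then have H0: "fps_nth H 0 = 0"
      using c3 by (metis mult.assoc mult_cancel_right1)
    \<comment> \<open>As \<open>fps_nth K 1\<close> and \<open>fps_nth H 0\<close> vanish, this
      equation repeats the one of order 1, with \<open>fps_nth H 1\<close> in the role of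
      \<open>h 0\<close>.\<close>
    have "fps_nth K 2 + c * (cnj c * fps_nth H 1) = fps_nth H 1"
      using arg_cong[OF h(4), of "\<lambda>F. fps_nth F 2"] K0(2) H0 
      by (simp add: c_def fps_mult_nth numeral_2_eq_2 add.commute)
    then have "fps_nth K 2 = of_real (1 - (norm c)\<^sup>2) * fps_nth H 1"
      by (simp only: of_real_diff of_real_1 complex_norm_square) (simp add: algebra_simps)
    then have "norm (fps_nth K 2) = (1 - (norm c)\<^sup>2) * norm (fps_nth H 1)"
      using c2 by (simp only: norm_mult norm_of_real)
    also have "\<dots> \<le> (1 - (norm c)\<^sup>2) * 1"
      using schwarz_pick_coeff_1[OF h(1-3)] H0 c2 by (intro mult_left_mono) auto
    finally show ?thesis
      using K0 by (simp add: c_def)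
  qed
qed

text \<open>Dividing by \<open>z\<close> gives \<open>w z = z * g z\<close>, and a Schur step takes
  \<open>g\<close> to \<open>h\<close>. The parameters \<open>x\<close>, \<open>s\<close>,
  \<open>t\<close> are the coefficients of \<open>h\<close> of orders 0, 1, 2, so both estimates
  above apply to them.\<close>

lemma schwarz_function_coeffs:
  assumes "w holomorphic_on \<D>" "w ` \<D> \<subseteq> \<D>" "w 0 = 0" "w has_fps_expansion W"
  obtains x s t where "norm (fps_nth W 1) \<le> 1" "norm x \<le> 1"
    "norm s \<le> 1 - (norm x)\<^sup>2" "norm t \<le> 1 - (norm x)\<^sup>2"
    "fps_nth W 2 = (1 - fps_nth W 1 * cnj (fps_nth W 1)) * x"
    "fps_nth W 3 = (1 - fps_nth W 1 * cnj (fps_nth W 1)) * (s - cnj (fps_nth W 1) * x\<^sup>2)"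
    "fps_nth W 4 = (1 - fps_nth W 1 * cnj (fps_nth W 1)) *
       (t - 2 * cnj (fps_nth W 1) * x * s + (cnj (fps_nth W 1))\<^sup>2 * x^3)"
proof -
  have "norm (w z) < 1" if "z \<in> \<D>" for z
    using assms(2) that by (metis image_subset_iff mem_ball_0)
  then obtain g where g: "g holomorphic_on \<D>" "\<And>z. z \<in> \<D> \<Longrightarrow> norm (g z) \<le> 1"
    "\<And>z. z \<in> \<D> \<Longrightarrow> w z = z * g z"
    using schwarz_quotient[OF assms(1,3)] by blast
  define G where "G = fps_expansion g 0"
  have G: "g has_fps_expansion G"
    unfolding G_def using g(1) by (rule fps_expansion_disk)
  have W: "W = fps_X * G"
    by (rule fps_eq_on_disk[OF assms(4) _ g(3)]) (intro fps_expansion_intros G)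
  define c where "c = fps_nth G 0"
  have W1: "fps_nth W 1 = c"
    by (simp add: W c_def)
  have c_le: "norm c \<le> 1"
    using g(2)[of 0] by (simp add: c_def fps_nth_0_expansion[OF G])
  show ?thesis
  proof (cases "norm (g 0) = 1")
    case True
    then have "G = fps_const (g 0)"
      using max_modulus_attained_at_0 g
      by (intro fps_expansion_constant_on_disk[OF G]) blast
    \<comment> \<open>Here \<open>w\<close> is a rotation, and zero parameters satisfy all three
      equations.\<close>
    then have "fps_nth W n = 0" if "n \<ge> 2" for n
      using that by (simp add: W)
    then show ?thesis
      using c_le W1 by (intro that[of 0 0 0]) auto
  next
    case False
    with g(2)[of 0] have "norm (g 0) < 1" by simp
    then obtain h H where h: "h holomorphic_on \<D>" "\<And>z. z \<in> \<D> \<Longrightarrow> norm (h z) \<le> 1"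
      "h has_fps_expansion H"
      "G * (1 + fps_const (cnj c) * (fps_X * H)) = fps_const c + fps_X * H"
      using schur_step_fps[OF g(1,2) _ G] unfolding c_def by blast
    have nth: "fps_nth (G * (1 + fps_const (cnj c) * (fps_X * H))) n = fps_nth (fps_const c + fps_X * H) n" for n
      using h(4) by simp
    have G1: "fps_nth G 1 = (1 - c * cnj c) * fps_nth H 0"
      using nth[of 1] by (simp add: c_def algebra_simps)
    have "fps_nth G 2 = fps_nth H 1 - fps_nth G 1 * cnj c * fps_nth H 0 - c * cnj c * fps_nth H 1"
      using nth[of 2] by (simp add: fps_mult_nth numeral_eq_Suc eq_diff_eq flip: c_def) (simp add: algebra_simps)
    then have G2: "fps_nth G 2 = (1 - c * cnj c) * (fps_nth H 1 - cnj c * (fps_nth H 0)\<^sup>2)"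
      unfolding G1 by (simp add: algebra_simps power2_eq_square)
    have "fps_nth G 3 = fps_nth H 2 - fps_nth G 2 * cnj c * fps_nth H 0
        - fps_nth G 1 * cnj c * fps_nth H 1 - c * cnj c * fps_nth H 2"
      using nth[of 3] by (simp add: fps_mult_nth numeral_eq_Suc eq_diff_eq flip: c_def) (simp add: algebra_simps)
    then have G3: "fps_nth G 3 = (1 - c * cnj c) *
        (fps_nth H 2 - 2 * cnj c * fps_nth H 0 * fps_nth H 1 + (cnj c)\<^sup>2 * (fps_nth H 0)^3)"
      unfolding G1 G2 by (simp add: algebra_simps power2_eq_square power3_eq_cube)
    show ?thesis
    proof (rule that[of "fps_nth H 0" "fps_nth H 1" "fps_nth H 2"])
      show "norm (fps_nth H 0) \<le> 1"
        using h(2)[of 0] by (simp add: fps_nth_0_expansion[OF h(3)])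
      show "norm (fps_nth H 1) \<le> 1 - (norm (fps_nth H 0))\<^sup>2" 
        "norm (fps_nth H 2) \<le> 1 - (norm (fps_nth H 0))\<^sup>2"
        using schwarz_pick_coeff_1[OF h(1-3)] schwarz_pick_coeff_2[OF h(1-3)] by auto
    qed (use c_le G1 G2 G3 in \<open>simp_all only: W1\<close>, simp_all add: W c_def)
  qed
qed

subsection \<open>The bound in Schur parameters\<close>

text \<open>The left side is the termwise majorant of 64 times the determinant, \<open>p\<close> and
  \<open>y\<close> being the moduli of \<open>c\<close> and \<open>x\<close>. Equality holds at
  \<open>p = 0\<close>, \<open>y = 1\<close>, so every estimate must be exact there.\<close>

lemma schur_polynomial_le_3:
  fixes p y :: real
  assumes "0 \<le> p" "p \<le> 1" "0 \<le> y" "y \<le> 1"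
  defines "P \<equiv> p\<^sup>2" and "q \<equiv> 1 - p\<^sup>2" and "m \<equiv> 1 - y\<^sup>2"
  shows "75/256 * P^3 + 47/32 * P^2 * q * y + (3/8 * P + 43/16 * q) * P * q * y^2
      + (3/2 * P^2 + 3/2 * P * q + 3 * q^2) * q * y^3 + P * q^2 * y^4
      + p * q * (3/8 * P + 3 * P * y + 3/2 * q * y + 2 * q * y^2) * m
      + q^2 * m^2 + (3/2 * P + 2 * q * y) * q * m \<le> 3"
    (is "?R + p * q * ?S * m + ?T + ?U \<le> 3")
proof -
  define z where "z = 1 - y"
  have P: "0 \<le> P" "0 \<le> q" "P = 1 - q"
    using assms by (auto simp: power_le_one)
  have "0 \<le> z" "0 \<le> m"
    using assms by (auto simp: z_def power_le_one)
  have "p \<le> 1/4 + P"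
    using zero_le_power2[of "p - 1/2"] by (simp add: P_def power2_eq_square algebra_simps)
  then have "p * q * ?S * m \<le> (1/4 + P) * q * ?S * m"
    using assms(3) P \<open>0 \<le> m\<close> by (intro mult_right_mono) auto
  \<comment> \<open>The Bernstein expansion in both variables; all its coefficients are nonnegative.\<close>
  moreover have "3 - (?R + (1/4 + P) * q * ?S * m + ?T + ?U) =
      q^3 * (2 * z^4 + 45/8 * y * z^3 + 51/8 * y^2 * z^2 + 13/4 * y^3 * z)
      + P * q^2 * (205/32 * z^4 + 21 * y * z^3 + 735/32 * y^2 * z^2 + 187/16 * y^3 * z + 61/16 * y^4)
      + P^2 * q * (225/32 * z^4 + 733/32 * y * z^3 + 225/8 * y^2 * z^2 + 573/32 * y^3 * z + 181/32 * y^4)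
      + 693/256 * P^3"
    unfolding \<open>P = 1 - q\<close> m_def z_def by (simp add: field_simps power_numeral_reduce)
  moreover have "0 \<le> \<dots>"
    using assms(3) P \<open>0 \<le> z\<close> by (intro add_nonneg_nonneg mult_nonneg_nonneg) auto
  ultimately show ?thesis
    by linarith
qed

text \<open>The determinant is a polynomial in the Schwarz coefficients \<open>c\<close>,
  \<open>c2\<close>, \<open>c3\<close>, \<open>c4\<close>. Once it is expanded in \<open>c\<close>,
  \<open>x\<close>, \<open>s\<close>, \<open>t\<close>, its terms are bounded through
  \<open>|c|\<close> and \<open>|x|\<close> alone.\<close>

lemma schur_hankel_bound:
  fixes c x s t :: complex
  assumes "norm c \<le> 1" "norm x \<le> 1" "norm s \<le> 1 - (norm x)\<^sup>2" "norm t \<le> 1 - (norm x)\<^sup>2"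
  defines "q \<equiv> 1 - c * cnj c"
  defines "c2 \<equiv> q * x" and "c3 \<equiv> q * (s - cnj c * x\<^sup>2)"
    and "c4 \<equiv> q * (t - 2 * cnj c * x * s + (cnj c)\<^sup>2 * x^3)"
  shows "norm ((3/16 * c\<^sup>2 - c2/4) *
      (43/256 * c^4 - c\<^sup>2 * c2 / 2 + c * c3 / 4 + 3/16 * c2\<^sup>2 - c4/8)
      - (21/128 * c^3 - 11/32 * c * c2 + c3/8)\<^sup>2) \<le> 3/64" (is "norm ?H \<le> _")
proof -
  define p y where "p = norm c" and "y = norm x"
  define P Q m where "P = p\<^sup>2" and "Q = 1 - p\<^sup>2" and "m = 1 - y\<^sup>2"
  define d where "d = cnj c"
  have P0: "0 \<le> P" "0 \<le> Q" "0 \<le> y" "0 \<le> p" "y \<le> 1" "p \<le> 1"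
    using assms by (auto simp: P_def Q_def y_def p_def power_le_one)
  have "0 \<le> m" 
    using P0 by (auto simp: m_def power_le_one)
  have q: "q = of_real Q" "q = 1 - c * d"
    by (simp_all only: q_def Q_def p_def complex_norm_square of_real_diff of_real_1 d_def)
  have PP: "of_real P = c * d"
    by (simp only: P_def p_def complex_norm_square d_def)
  have nq: "norm q = Q" and nP: "norm (complex_of_real P) = P"
    using P0 by (simp_all add: q(1))
  have nd: "norm d = p"
    by (simp add: d_def p_def)
  \<comment> \<open>All terms have weight 6 under rotations of the disk, so replacing \<open>c * cnj c\<close> by its value
    \<open>P\<close> leaves no phases to compare.\<close>
  have H: "64 * ?H = 75/256 * c^6 - 47/32 * q * c^4 * x + (43/16 * q - 3/8 * of_real P) * q * c^2 * x^2
      - (3/2 * (of_real P)^2 + 3/2 * of_real P * q + 3 * q^2) * q * x^3 + q^2 * d^2 * x^4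
      + q * (3/8 * c^3 + 3 * of_real P * c * x + 3/2 * q * c * x - 2 * q * d * x^2) * s
      - q^2 * s^2 - (3/2 * c^2 - 2 * q * x) * q * t"
    unfolding c2_def c3_def c4_def PP d_def[symmetric] q(2) 
    by (simp add: field_simps power_numeral_reduce)
  have "64 * norm ?H = norm (64 * ?H)"
    by (subst norm_mult) simp
  \<comment> \<open>The triangle inequality is used between the summands and inside the bracketed
    factors; \<open>m\<close> bounds both \<open>|s|\<close> and \<open>|t|\<close>.\<close>
  also have "\<dots> \<le> 75/256 * p^6 + 47/32 * Q * p^4 * y + (43/16 * Q + 3/8 * P) * Q * p^2 * y^2
      + (3/2 * P^2 + 3/2 * P * Q + 3 * Q^2) * Q * y^3 + Q^2 * p^2 * y^4
      + Q * (3/8 * p^3 + 3 * P * p * y + 3/2 * Q * p * y + 2 * Q * p * y^2) * m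
      + Q^2 * m^2 + (3/2 * p^2 + 2 * Q * y) * Q * m"
    unfolding H using assms(3,4)
    by (intro order_trans[OF norm_triangle_ineq] order_trans[OF norm_triangle_ineq4] add_mono)
      (unfold norm_mult norm_power nq nd p_def[symmetric] y_def[symmetric] m_def[symmetric],
       (intro mult_mono power_mono order_trans[OF norm_triangle_ineq]
          order_trans[OF norm_triangle_ineq4] add_mono; 
         (simp add: norm_mult norm_power nq nd nP P0 \<open>0 \<le> m\<close> flip: p_def y_def)?)+)
  also have "\<dots> \<le> 3"
    using schur_polynomial_le_3[of p y] P0
    by (simp add: P_def Q_def m_def algebra_simps power_numeral_reduce)
  finally show ?thesis
    by simp
qed

subsection \<open>Coefficients of the inverse function\<close>

text \<open>Since \<open>F\<close> starts with \<open>X\<close>, the coefficient of order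
  \<open>n\<close> in \<open>A oo F\<close> is \<open>fps_nth A n\<close> plus terms in earlier
  coefficients of \<open>A\<close>, so the system is solved from the bottom up.\<close>

lemma compositional_inverse_coeffs:
  fixes A F :: "complex fps"
  assumes "A oo F = fps_X" "fps_nth F 0 = 0" "fps_nth F 1 = 1"
  defines "a \<equiv> fps_nth F"
  shows "fps_nth A 3 = 2 * (a 2)\<^sup>2 - a 3"
    and "fps_nth A 4 = - 5 * (a 2)^3 + 5 * a 2 * a 3 - a 4"
    and "fps_nth A 5 = 14 * (a 2)^4 - 21 * (a 2)\<^sup>2 * a 3 + 6 * a 2 * a 4 + 3 * (a 3)\<^sup>2 - a 5"
proof -
  have nth: "fps_nth (A oo F) n = fps_nth fps_X n" for n
    using assms(1) by simp
  \<comment> \<open>Numerals are unfolded to successors so that the convolution sums expand; hence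
    the normalisation must be stated at \<open>Suc 0\<close>.\<close>
  note [simp] = fps_compose_nth fps_mult_nth numeral_eq_Suc assms(2,3)[unfolded One_nat_def]
  have A0: "fps_nth A 0 = 0"
    using nth[of 0] by simp
  have A1: "fps_nth A 1 = 1"
    using nth[of 1] by simp
  have A2: "fps_nth A 2 = - a 2"
    using nth[of 2] A0 A1 by (simp add: a_def eq_neg_iff_add_eq_0 add.commute)
  have "a 3 + fps_nth A 2 * (2 * a 2) + fps_nth A 3 = 0"
    using nth[of 3] A0 A1 by (simp add: a_def algebra_simps)
  then show A3: "fps_nth A 3 = 2 * (a 2)\<^sup>2 - a 3"
    unfolding A2 by (simp add: algebra_simps power2_eq_square add_eq_0_iff)
  have "a 4 + fps_nth A 2 * (2 * a 3 + (a 2)\<^sup>2) + fps_nth A 3 * (3 * a 2) + fps_nth A 4 = 0"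
    using nth[of 4] A0 A1 by (simp add: a_def algebra_simps)
  then show A4: "fps_nth A 4 = - 5 * (a 2)^3 + 5 * a 2 * a 3 - a 4"
    unfolding A2 A3 by (simp add: algebra_simps power2_eq_square power3_eq_cube add_eq_0_iff)
  have "a 5 + fps_nth A 2 * (2 * a 4 + 2 * a 2 * a 3) + fps_nth A 3 * (3 * a 3 + 3 * (a 2)\<^sup>2)
      + fps_nth A 4 * (4 * a 2) + fps_nth A 5 = 0"
    using nth[of 5] A0 A1 by (simp add: a_def algebra_simps)
  then show "fps_nth A 5 = 14 * (a 2)^4 - 21 * (a 2)\<^sup>2 * a 3 + 6 * a 2 * a 4 + 3 * (a 3)\<^sup>2 - a 5"
    unfolding A2 A3 A4 by (simp add: algebra_simps power_numeral_reduce add_eq_0_iff)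
qed

lemma inverse_fps_expansion:
  assumes "f holomorphic_on \<D>" "inj_on f \<D>" "f 0 = 0" "f has_fps_expansion F"
  shows "fps_expansion (inv_into \<D> f) 0 oo F = fps_X"
proof -
  obtain g where g: "g holomorphic_on f ` \<D>" "\<And>z. z \<in> \<D> \<Longrightarrow> g (f z) = z"
    using holomorphic_has_inverse[OF assms(1) open_ball assms(2)] by metis
  have "inv_into \<D> f holomorphic_on f ` \<D>"
    using g(1) by (rule holomorphic_transform) (use assms(2) g(2) in auto)
  moreover have "open (f ` \<D>)" 
    using open_mapping_thm3[OF assms(1) _ assms(2)] by auto
  moreover have "0 \<in> f ` \<D>"
    using assms(3) by (metis centre_in_ball imageI zero_less_one)
  ultimately have "inv_into \<D> f has_fps_expansion fps_expansion (inv_into \<D> f) 0"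
    by (intro has_fps_expansion_fps_expansion) auto
  then have "(inv_into \<D> f \<circ> f) has_fps_expansion (fps_expansion (inv_into \<D> f) 0 oo F)"
    using assms(3,4) by (intro has_fps_expansion_compose) (auto simp: fps_nth_0_expansion)
  then show ?thesis
    by (rule fps_eq_on_disk[OF _ has_fps_expansion_fps_X]) (use assms(2) in auto)
qed

section \<open>From the Schwarz function to the Hankel determinant\<close>

text \<open>Both equations are triangular. The square determines \<open>Q\<close> from
  \<open>W\<close> because \<open>Q\<close> starts with 1. The difference
  \<open>F - (F oo - fps_X)\<close> keeps the odd coefficients, doubled, so order \<open>n\<close>
  of \<open>ode\<close> gives \<open>fps_nth F n\<close> from earlier ones.\<close>

lemma sakaguchi_sqrt_coeffs:
  fixes F Q W :: "complex fps"
  assumes "fps_nth F 0 = 0" "fps_nth F 1 = 1" "fps_nth Q 0 = 1" "fps_nth W 0 = 0"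
    and ode: "2 * fps_X * fps_deriv F = (F - (F oo - fps_X)) * Q"
    and sq: "Q\<^sup>2 = 1 + W"
  defines "c \<equiv> fps_nth W"
  shows "fps_nth F 2 = c 1 / 4"
    and "fps_nth F 3 = c 2 / 4 - (c 1)\<^sup>2 / 16"
    and "fps_nth F 4 = c 3 / 8 - c 1 * c 2 / 32 + (c 1)^3 / 128"
    and "fps_nth F 5 = c 4 / 8 - c 1 * c 3 / 16 + (c 1)\<^sup>2 * c 2 / 32 - (c 1)^4 / 128"
proof -
  define a q where "a = fps_nth F" and "q = fps_nth Q"
  note [simp] = fps_mult_nth numeral_eq_Suc power2_eq_square
  note init = assms(1-4)[unfolded One_nat_def]
  have nq: "fps_nth (Q * Q) n = fps_nth (1 + W) n" for n
    using sq by simp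
  have nf: "fps_nth ((fps_const 2 * fps_X) * fps_deriv F) n = fps_nth ((F - (F oo - fps_X)) * Q) n" for n
    using ode by (simp only: numeral_fps_const)
  have "2 * q 1 = c 1"
    using nq[of 1] init by (simp add: q_def c_def)
  moreover have "2 * q 2 + q 1 * q 1 = c 2"
    using nq[of 2] init by (simp add: q_def c_def)
  moreover have "2 * q 3 + 2 * q 1 * q 2 = c 3"
    using nq[of 3] init by (simp add: q_def c_def algebra_simps)
  moreover have "2 * q 4 + 2 * q 1 * q 3 + q 2 * q 2 = c 4"
    using nq[of 4] init by (simp add: q_def c_def algebra_simps)
  ultimately have q: "q 1 = c 1 / 2" "q 2 = (c 2 - q 1 * q 1) / 2" "q 3 = (c 3 - 2 * q 1 * q 2) / 2"
    "q 4 = (c 4 - 2 * q 1 * q 3 - q 2 * q 2) / 2"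
    by (simp_all add: field_simps)
  have "4 * a 2 = 2 * q 1" "6 * a 3 = 2 * a 3 + 2 * q 2" "8 * a 4 = 2 * q 3 + 2 * a 3 * q 1"
    "10 * a 5 = 2 * a 5 + 2 * a 3 * q 2 + 2 * q 4"
    using nf[of 2] nf[of 3] nf[of 4] nf[of 5] init
    by (simp_all add: a_def q_def fps_compose_uminus' algebra_simps)
  then have a: "a 2 = q 1 / 2" "a 3 = q 2 / 2" "a 4 = (q 1 * q 2 + 2 * q 3) / 8" "a 5 = (q 2 * q 2 + 2 * q 4) / 8"
    by (simp_all add: field_simps)
  show "fps_nth F 2 = c 1 / 4"
    and "fps_nth F 3 = c 2 / 4 - (c 1)\<^sup>2 / 16"
    and "fps_nth F 4 = c 3 / 8 - c 1 * c 2 / 32 + (c 1)^3 / 128"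
    and "fps_nth F 5 = c 4 / 8 - c 1 * c 3 / 16 + (c 1)\<^sup>2 * c 2 / 32 - (c 1)^4 / 128"
    unfolding a_def[symmetric] a q by (simp_all add: field_simps)
qed

lemma Re_one_plus_pos:
  assumes "norm (z :: complex) < 1"
  shows "Re (1 + z) > 0"
  using abs_Re_le_cmod[of z] assms by simp

text \<open>The values of \<open>1 + w\<close> lie in the right half-plane, off the branch
  cut.\<close>

lemma csqrt_one_plus_holomorphic:
  assumes "w holomorphic_on \<D>" "\<And>z. z \<in> \<D> \<Longrightarrow> norm (w z) < 1"
  shows "(\<lambda>z. csqrt (1 + w z)) holomorphic_on \<D>"
proof -
  have "1 + w z \<notin> \<real>\<^sub>\<le>\<^sub>0" if "z \<in> \<D>" for z
    using Re_one_plus_pos[OF assms(2)[OF that]] by (auto simp: complex_nonpos_Reals_iff)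
  then show ?thesis
    using assms(1) by (intro holomorphic_intros) auto
qed

lemma hankel_eq_schwarz_coeffs:
  assumes f: "f \<in> class_S"
    and w: "w holomorphic_on \<D>" "w ` \<D> \<subseteq> \<D>" "w 0 = 0"
    and eq: "\<And>z. z \<in> \<D> \<Longrightarrow> sakaguchi_quotient f z = csqrt (1 + w z)"
    and W: "w has_fps_expansion W"
  defines "c \<equiv> fps_nth W"
  shows "hankel_2_3_inverse f = (3/16 * (c 1)\<^sup>2 - c 2 / 4) *
      (43/256 * (c 1)^4 - (c 1)\<^sup>2 * c 2 / 2 + c 1 * c 3 / 4 + 3/16 * (c 2)\<^sup>2 - c 4 / 8)
      - (21/128 * (c 1)^3 - 11/32 * c 1 * c 2 + c 3 / 8)\<^sup>2"
proof -
  have S: "f holomorphic_on \<D>" "inj_on f \<D>" "f 0 = 0" "deriv f 0 = 1"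
    using f by (auto simp: class_S_def)
  define F where "F = fps_expansion f 0"
  have F: "f has_fps_expansion F"
    unfolding F_def using S(1) by (rule fps_expansion_disk)
  have F01: "fps_nth F 0 = 0" "fps_nth F 1 = 1"
    using S(3,4) fps_nth_fps_expansion[OF F] by simp_all
  have wlt: "norm (w z) < 1" if "z \<in> \<D>" for z
    using w(2) that by (metis image_subset_iff mem_ball_0)
  define Q where "Q = fps_expansion (\<lambda>z. csqrt (1 + w z)) 0"
  have Q: "(\<lambda>z. csqrt (1 + w z)) has_fps_expansion Q"
    unfolding Q_def by (intro fps_expansion_disk csqrt_one_plus_holomorphic w(1) wlt)
  have "Q\<^sup>2 = 1 + W"
    by (rule fps_eq_on_disk[OF has_fps_expansion_power[OF Q]
          has_fps_expansion_add[OF has_fps_expansion_1 W]]) simp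
  \<comment> \<open>Clearing the denominator removes the exceptional value of the quotient at 0,
    where both sides vanish. Elsewhere injectivity keeps the denominator nonzero.\<close>
  moreover have "2 * fps_X * fps_deriv F = (F - (F oo - fps_X)) * Q"
  proof (rule fps_eq_on_disk)
    show "(\<lambda>z. 2 * z * deriv f z) has_fps_expansion 2 * fps_X * fps_deriv F"
      by (intro fps_expansion_intros F)
    have "(\<lambda>z. f (- z)) has_fps_expansion (F oo - fps_X)"
      using has_fps_expansion_compose[OF F, of uminus "- fps_X"]
      by (simp add: o_def has_fps_expansion_minus has_fps_expansion_fps_X)
    then show "(\<lambda>z. (f z - f (- z)) * csqrt (1 + w z)) has_fps_expansion (F - (F oo - fps_X)) * Q"
      by (intro has_fps_expansion_mult has_fps_expansion_diff F Q)
    show "2 * z * deriv f z = (f z - f (- z)) * csqrt (1 + w z)" if "z \<in> \<D>" for z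
    proof (cases "z = 0")
      case False
      then have "f z \<noteq> f (- z)"
        using inj_onD[OF S(2), of z "- z"] that by auto
      then show ?thesis
        using eq[OF that] False by (simp add: sakaguchi_quotient_def field_simps)
    qed simp
  qed
  moreover have "fps_nth Q 0 = 1" "fps_nth W 0 = 0"
    using w(3) by (simp_all add: fps_nth_0_expansion[OF Q] fps_nth_0_expansion[OF W])
  ultimately have a: "fps_nth F 2 = c 1 / 4" "fps_nth F 3 = c 2 / 4 - (c 1)\<^sup>2 / 16"
    "fps_nth F 4 = c 3 / 8 - c 1 * c 2 / 32 + (c 1)^3 / 128"
    "fps_nth F 5 = c 4 / 8 - c 1 * c 3 / 16 + (c 1)\<^sup>2 * c 2 / 32 - (c 1)^4 / 128"
    using sakaguchi_sqrt_coeffs[OF F01, of Q W] unfolding c_def by blast+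
  show ?thesis
    unfolding hankel_2_3_inverse_def inverse_coeff_def
      compositional_inverse_coeffs[OF inverse_fps_expansion[OF S(1-3) F] F01] a
    by (simp add: field_simps power_numeral_reduce)
qed

subsection \<open>The extremal function\<close>

text \<open>The principal root has nonnegative real part, and the square of an imaginary number has
  nonpositive real part.\<close>

lemma Re_csqrt_pos:
  assumes "Re z > 0"
  shows "Re (csqrt z) > 0"
proof (rule ccontr)
  assume "\<not> Re (csqrt z) > 0"
  then have "Re (csqrt z) = 0"
    using Re_csqrt[of z] by simp
  then have "Re ((csqrt z)\<^sup>2) \<le> 0"
    by (simp add: Re_power2 del: power2_csqrt)
  then show False
    using assms by (simp only: power2_csqrt)
qed

text \<open>The Noshiro-Warschawski criterion: the mean value theorem along the segment joining two
  points with equal values.\<close>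

lemma Re_deriv_pos_imp_inj_on:
  assumes "convex S" "\<And>z. z \<in> S \<Longrightarrow> (f has_field_derivative f' z) (at z)"
    and "\<And>z. z \<in> S \<Longrightarrow> Re (f' z) > 0"
  shows "inj_on f S"
proof (rule inj_onI, rule ccontr)
  fix a b assume ab: "a \<in> S" "b \<in> S" "f a = f b" "a \<noteq> b"
  have seg: "u \<in> S" if "u \<in> closed_segment a b" for u
    using closed_segment_subset[OF ab(1,2) assms(1)] that by blast
  \<comment> \<open>Dividing \<open>f\<close> by \<open>b - a\<close> makes the right side
    \<open>Re (f' u)\<close>, while the left side is 0.\<close>
  have "\<exists>u. u \<in> closed_segment a b \<and>
      Re (f b / (b - a)) - Re (f a / (b - a)) = Re (f' u / (b - a) * (b - a))"
    by (rule complex_mvt_line) (use assms(2) seg in \<open>auto intro!: DERIV_cdivide\<close>)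
  then show False
    using assms(3) seg ab by force
qed

definition extremal_sqrt :: "complex \<Rightarrow> complex" where
  "extremal_sqrt z = csqrt (1 + z\<^sup>2)"

text \<open>The odd solution of \<open>z * f' z = csqrt (1 + z\<^sup>2) * f z\<close>, from
  \<open>\<integral> sqrt (1 + z\<^sup>2) / z dz = s + ln (z / (1 + s))\<close> with \<open>s = sqrt (1 + z\<^sup>2)\<close>.\<close>

definition extremal :: "complex \<Rightarrow> complex" where
  "extremal z = 2 * z * exp (extremal_sqrt z - 1) / (1 + extremal_sqrt z)"

lemma Re_extremal_sqrt: "norm z < 1 \<Longrightarrow> Re (extremal_sqrt z) > 0"
  unfolding extremal_sqrt_def 
  by (intro Re_csqrt_pos Re_one_plus_pos) (simp add: norm_power abs_square_less_1)

lemma extremal_sqrt_nonzero: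
  assumes "norm z < 1"
  shows "extremal_sqrt z \<noteq> 0" "1 + extremal_sqrt z \<noteq> 0"
  using Re_extremal_sqrt[OF assms] by (auto simp: complex_eq_iff)

lemma power2_extremal_sqrt: "(extremal_sqrt z)\<^sup>2 = 1 + z\<^sup>2"
  by (simp add: extremal_sqrt_def)

lemma DERIV_extremal_sqrt:
  assumes "norm z < 1"
  shows "(extremal_sqrt has_field_derivative z / extremal_sqrt z) (at z)"
proof -
  have "norm (z\<^sup>2) < 1"
    using assms by (simp add: norm_power abs_square_less_1)
  then have "1 + z\<^sup>2 \<notin> \<real>\<^sub>\<le>\<^sub>0"
    using Re_one_plus_pos[of "z\<^sup>2"] by (auto simp: complex_nonpos_Reals_iff)
  then show ?thesis
    unfolding extremal_sqrt_def by (auto intro!: derivative_eq_intros simp: field_simps)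
qed

text \<open>This is \<open>extremal_sqrt z * extremal z / z\<close> with \<open>z\<close> cancelled,
  a form that also covers \<open>z = 0\<close>.\<close>

lemma DERIV_extremal:
  assumes "norm z < 1"
  shows "(extremal has_field_derivative
    2 * exp (extremal_sqrt z - 1) * extremal_sqrt z / (1 + extremal_sqrt z)) (at z)"
proof -
  define s where "s = extremal_sqrt z"
  define e where "e = exp (s - 1)"
  have s: "s \<noteq> 0" "1 + s \<noteq> 0" "z\<^sup>2 = s\<^sup>2 - 1"
    using extremal_sqrt_nonzero[OF assms] power2_extremal_sqrt[of z] by (auto simp: s_def)
  \<comment> \<open>The left side is the raw outcome of the quotient rule. It contains
    \<open>z\<close> only through \<open>z^2\<close>, which becomes \<open>s^2 - 1\<close>.\<close>
  have "((2 * e + 2 * z * (e * (z / s))) * (1 + s) - 2 * z * e * (z / s)) / ((1 + s) * (1 + s))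
      = (2 * e + 2 * e * (z\<^sup>2 / s)) / (1 + s) - 2 * e * (z\<^sup>2 / s) / (1 + s)\<^sup>2"
    using s(2) by (simp add: divide_simps power2_eq_square)
  also have "\<dots> = 2 * e * s / (1 + s)"
    unfolding s(3) using s(1,2) by (simp add: divide_simps) (simp add: algebra_simps power2_eq_square)
  finally have *: "((2 * e + 2 * z * (e * (z / s))) * (1 + s) - 2 * z * e * (z / s)) / ((1 + s) * (1 + s)) = 2 * e * s / (1 + s)" .
  show ?thesis
    unfolding extremal_def[abs_def] e_def[symmetric] s_def[symmetric] *[symmetric]
    by (rule derivative_eq_intros DERIV_extremal_sqrt[OF assms] refl)+
      (use s in \<open>auto simp: e_def s_def algebra_simps\<close>)
qed

text \<open>In the variable \<open>\<zeta> = ln z\<close> the function \<open>ln f\<close> has derivative \<open>csqrt (1 + z\<^sup>2)\<close>, of positive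
  real part, and the left half-plane is convex.\<close>

lemma inj_on_log_extremal:
  "inj_on (\<lambda>\<zeta>. \<zeta> + extremal_sqrt (exp \<zeta>) - 1 - Ln (1 + extremal_sqrt (exp \<zeta>))) {\<zeta>. Re \<zeta> < 0}"
proof (rule Re_deriv_pos_imp_inj_on)
  show "convex {\<zeta>. Re \<zeta> < 0}"
    by (rule convex_halfspace_Re_lt)
next
  fix \<zeta> :: complex assume "\<zeta> \<in> {\<zeta>. Re \<zeta> < 0}"
  then have n: "norm (exp \<zeta>) < 1" by simp
  define z s where "z = exp \<zeta>" and "s = extremal_sqrt z"
  have s: "s \<noteq> 0" "1 + s \<noteq> 0" "z\<^sup>2 = s\<^sup>2 - 1"
    using extremal_sqrt_nonzero[OF n] power2_extremal_sqrt[of z] by (auto simp: s_def z_def)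
  have "1 + s \<notin> \<real>\<^sub>\<le>\<^sub>0"
    using Re_extremal_sqrt[OF n] by (auto simp: complex_nonpos_Reals_iff s_def z_def)
  have d: "((\<lambda>\<zeta>. extremal_sqrt (exp \<zeta>)) has_field_derivative z / s * z) (at \<zeta>)"
    using DERIV_chain[OF DERIV_extremal_sqrt[OF n] DERIV_exp] by (simp add: o_def z_def s_def)
  have dL: "((\<lambda>\<zeta>. Ln (1 + extremal_sqrt (exp \<zeta>))) has_field_derivative z / s * z / (1 + s)) (at \<zeta>)"
    using DERIV_chain2[OF has_field_derivative_Ln DERIV_add[OF DERIV_const d], of 1]
      \<open>1 + s \<notin> \<real>\<^sub>\<le>\<^sub>0\<close> by (simp add: s_def z_def field_simps)
  \<comment> \<open>The two fractions combine to \<open>z^2 / (1 + s) = s - 1\<close>.\<close>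
  have "1 + z / s * z - z / s * z / (1 + s) = 1 + z\<^sup>2 / s - z\<^sup>2 / s / (1 + s)"
    by (simp add: power2_eq_square)
  also have "\<dots> = s"
    unfolding s(3) using s(1,2) by (simp add: divide_simps) (simp add: algebra_simps power2_eq_square)
  finally have *: "1 + z / s * z - z / s * z / (1 + s) = s" .
  have "((\<lambda>\<zeta>. \<zeta> + extremal_sqrt (exp \<zeta>) - 1 - Ln (1 + extremal_sqrt (exp \<zeta>)))
      has_field_derivative 1 + z / s * z - z / s * z / (1 + s)) (at \<zeta>)"
    by (rule dL d derivative_eq_intros refl)+ simp
  then show "((\<lambda>\<zeta>. \<zeta> + extremal_sqrt (exp \<zeta>) - 1 - Ln (1 + extremal_sqrt (exp \<zeta>)))
      has_field_derivative extremal_sqrt (exp \<zeta>)) (at \<zeta>)"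
    unfolding * by (simp add: s_def z_def)
  show "Re (extremal_sqrt (exp \<zeta>)) > 0"
    using n by (rule Re_extremal_sqrt)
qed

text \<open>Nonzero points lift through \<open>exp\<close> to the left half-plane, where the
  logarithm of the function is injective; the value 0 is taken only at 0.\<close>

lemma inj_on_extremal: "inj_on extremal \<D>"
proof (rule inj_onI)
  fix a b assume ab: "a \<in> \<D>" "b \<in> \<D>" "extremal a = extremal b"
  let ?L = "\<lambda>\<zeta>. \<zeta> + extremal_sqrt (exp \<zeta>) - 1 - Ln (1 + extremal_sqrt (exp \<zeta>))"
  have zero: "extremal z = 0 \<longleftrightarrow> z = 0" if "z \<in> \<D>" for z
    using extremal_sqrt_nonzero[of z] that by (simp add: extremal_def)
  have log: "extremal z = 2 * exp (?L (Ln z))" if "z \<in> \<D>" "z \<noteq> 0" for z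
    using extremal_sqrt_nonzero[of z] that by (simp add: extremal_def exp_diff exp_add)
  have neg: "Re (Ln z) < 0" if "z \<in> \<D>" "z \<noteq> 0" for z
    using that by simp
  show "a = b"
  proof (cases "a = 0")
    case True
    then show ?thesis
      using ab zero by metis
  next
    case False
    then have nz: "a \<noteq> 0" "b \<noteq> 0"
      using ab zero by metis+
    have "exp (?L (Ln a)) = exp (?L (Ln b))"
      using ab(3) log[OF ab(1) nz(1)] log[OF ab(2) nz(2)] by simp
    then obtain n :: int where n: "?L (Ln a) = ?L (Ln b) + (of_int (2 * n) * pi) * \<i>"
      unfolding exp_eq by blast
    \<comment> \<open>Apart from its linear term, \<open>?L\<close> depends on its argument only
      through \<open>exp\<close>, so moving \<open>Ln b\<close> by this period absorbs the ambiguity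
      of the logarithm.\<close>
    define \<zeta> where "\<zeta> = Ln b + (of_int (2 * n) * pi) * \<i>"
    have e: "exp \<zeta> = b"
      unfolding \<zeta>_def using nz exp_eq[of "\<zeta>" "Ln b"] \<zeta>_def by auto
    have "?L (Ln a) = ?L \<zeta>"
      unfolding n e using nz by (simp add: \<zeta>_def)
    moreover have "Ln a \<in> {\<zeta>. Re \<zeta> < 0}" "\<zeta> \<in> {\<zeta>. Re \<zeta> < 0}"
      using neg[OF ab(1) nz(1)] neg[OF ab(2) nz(2)] by (simp_all add: \<zeta>_def)
    ultimately have "Ln a = \<zeta>"
      using inj_on_log_extremal by (rule inj_onD[rotated])
    then show "a = b"
      using e nz by (metis exp_Ln)
  qed
qed

lemma extremal_in_class_S: "extremal \<in> class_S"
proof -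
  have "extremal holomorphic_on \<D>"
    using DERIV_extremal by (intro holomorphic_onI) (force simp: field_differentiable_def intro: DERIV_subset)
  moreover have "deriv extremal 0 = 1"
    using DERIV_imp_deriv[OF DERIV_extremal[of 0]] by (simp add: extremal_sqrt_def)
  ultimately show ?thesis
    using inj_on_extremal by (simp add: class_S_def extremal_def)
qed

text \<open>The function is odd, so the quotient reduces to \<open>z * f' z / f z\<close>.\<close>

lemma sakaguchi_quotient_extremal:
  assumes "z \<in> \<D>"
  shows "sakaguchi_quotient extremal z = csqrt (1 + z\<^sup>2)"
proof (cases "z = 0")
  case True
  then show ?thesis
    by (simp add: sakaguchi_quotient_def)
next
  case False
  have "extremal z - extremal (- z) = 2 * extremal z"
    by (simp add: extremal_def extremal_sqrt_def)
  moreover have "deriv extremal z = 2 * exp (extremal_sqrt z - 1) * extremal_sqrt z / (1 + extremal_sqrt z)"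
    using DERIV_imp_deriv[OF DERIV_extremal] assms by simp
  ultimately have "sakaguchi_quotient extremal z = extremal_sqrt z"
    using False extremal_sqrt_nonzero[of z] assms 
    by (simp add: sakaguchi_quotient_def) (simp add: extremal_def)
  then show ?thesis
    by (simp add: extremal_sqrt_def)
qed

section \<open>The sharp bound\<close>

theorem theorem2p14:
  shows "(\<forall>f\<in>class_S_SL. norm (hankel_2_3_inverse f) \<le> 3 / 64) \<and>
         (\<exists>f\<in>class_S_SL. norm (hankel_2_3_inverse f) = 3 / 64)"
proof (intro conjI ballI)
  fix f assume "f \<in> class_S_SL"
  then obtain w where f: "f \<in> class_S" and w: "w holomorphic_on \<D>" "w ` \<D> \<subseteq> \<D>" "w 0 = 0"
    and eq: "\<And>z. z \<in> \<D> \<Longrightarrow> sakaguchi_quotient f z = csqrt (1 + w z)"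
    unfolding class_S_SL_def subordinate_def by blast
  define W where "W = fps_expansion w 0"
  have W: "w has_fps_expansion W"
    unfolding W_def using w(1) by (rule fps_expansion_disk)
  obtain x s t where xst: "norm (fps_nth W 1) \<le> 1" "norm x \<le> 1"
    "norm s \<le> 1 - (norm x)\<^sup>2" "norm t \<le> 1 - (norm x)\<^sup>2"
    and c: "fps_nth W 2 = (1 - fps_nth W 1 * cnj (fps_nth W 1)) * x"
      "fps_nth W 3 = (1 - fps_nth W 1 * cnj (fps_nth W 1)) * (s - cnj (fps_nth W 1) * x\<^sup>2)"
      "fps_nth W 4 = (1 - fps_nth W 1 * cnj (fps_nth W 1)) *
        (t - 2 * cnj (fps_nth W 1) * x * s + (cnj (fps_nth W 1))\<^sup>2 * x^3)"
    using schwarz_function_coeffs[OF w W] by blast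
  show "norm (hankel_2_3_inverse f) \<le> 3 / 64"
    by (subst hankel_eq_schwarz_coeffs[OF f w eq W], assumption)
      (unfold c, rule schur_hankel_bound[OF xst])
next
  have w: "(\<lambda>z. z\<^sup>2) holomorphic_on \<D>" "(\<lambda>z. z\<^sup>2) ` \<D> \<subseteq> \<D>" "(0::complex)\<^sup>2 = 0"
    by (auto intro!: holomorphic_intros simp: norm_power abs_square_less_1)
  have "(\<lambda>z::complex. z\<^sup>2) has_fps_expansion fps_X\<^sup>2"
    by (intro fps_expansion_intros)
  \<comment> \<open>The only nonzero Schwarz coefficient is \<open>c 2 = 1\<close>, which leaves
    \<open>(-1/4) * (3/16)\<close>.\<close>
  from hankel_eq_schwarz_coeffs[OF extremal_in_class_S w sakaguchi_quotient_extremal this]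
  have "hankel_2_3_inverse extremal = - 3 / 64"
    by (simp add: fps_X_power_nth)
  then have "norm (hankel_2_3_inverse extremal) = 3 / 64"
    by simp
  moreover have "extremal \<in> class_S_SL"
    unfolding class_S_SL_def subordinate_def
    using extremal_in_class_S sakaguchi_quotient_extremal w by (auto intro!: exI[of _ "\<lambda>z. z\<^sup>2"])
  ultimately show "\<exists>f\<in>class_S_SL. norm (hankel_2_3_inverse f) = 3 / 64"
    by blast
qed

end
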